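(* Let $B_n(x)$ denote the Bernoulli polynomials. The following polynomial identities in $x$ hold. (1) For $m\in\mathbb N$ and $\nu\in\mathbb N_0$ with $0\le \nu\le m$, $$\sum_{\substack{k=0\\ k+m\ \text{odd}}}^{m-1}\binom mk \binom{k+m}{\nu}\binom{k+m-\nu}{m-\nu}B_k(x) =\frac12\sum_{j=0}^{m-1}(-1)^{j+m+1}\binom m{j+1}\binom{j+m}{\nu}\binom{j+m-\nu}{m-\nu}(j+m+1)x^{j}.$$ (2) For $m\in\mathbb N$ and $0\le \nu\le m-1$, $$\sum_{\substack{k=0\\ k+m\ \text{odd}}}^{m-1}\binom mk \binom{k+m}{\nu}\binom{k+m-\nu}{m-\nu-1}B_{k+1}(x) =\frac12\sum_{j=0}^{m}(-1)^{j+m}\binom m{j}\binom{j+m-1}{\nu}\binom{j+m-\nu-1}{m-\nu-1}(j+m)x^{j}.$$ (3) For $m\in\mathbb N$, $0\le \nu\le m-1$ and $0\le \ell\le m-\nu-1$, $$\sum_{\substack{k=0\\ k+m\ \text{odd}}}^{m-1}\binom mk \binom{k+m}{\nu}\binom{k+m-\nu}{\ell}B_{k+m-\nu-\ell}(x) =\frac12\sum_{j=0}^{m}(-1)^{j+m}\binom m{j}\binom{j+m-1}{\nu}\binom{j+m-\nu-1}{\ell}(j+m)x^{j+m-\nu-\ell-1}.$$ (4) For $m\in\mathbb N$, $0\le \nu\le m$ and $0\le \ell\le m-1$, $$\sum_{\substack{k=\ell\\ k+m\ \text{odd}}}^{m-1}\binom mk \binom{k+m}{\nu}\binom{k+m-\nu}{\ell+m-\nu}B_{k-\ell}(x)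 =\frac12\sum_{j=\ell}^{m-1}(-1)^{j+m+1}\binom m{j+1}\binom{j+m}{\nu}\binom{j+m-\nu}{\ell+m-\nu}(j+m+1)x^{j-\ell}.$$
   Context: $\mathbb N=\{1,2,\dots\}$, $\mathbb N_0=\mathbb N\cup\{0\}$. The Bernoulli polynomials $B_n(x)$ are defined by the generating function $\frac{te^{xt}}{e^t-1}=\sum_{n\ge0}B_n(x)\frac{t^n}{n!}$. The notation $\sum_{k+m\ \text{odd}}$ means the sum runs only over those $k$ in the indicated range for which $k+m$ is odd. *)

theory Defs
  imports "HOL-Computational_Algebra.Computational_Algebra"
begin

(* The generating function t e^(xt) / (e^t - 1), as a power series in t over 'a[x].
   FPS division needs coefficients in a field, so the factor t / (e^t - 1), which does not
   involve x, is formed over 'a and its coefficients are then embedded as constant polynomials.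
   The other factor is e^(xt), with t^n-coefficient x^n / n!.  The lemmas after the definition
   of the Bernoulli polynomials give back the generating function at a point x. *)
definition bernoulli_gf :: "'a::field_char_0 poly fps" where
  "bernoulli_gf =
     Abs_fps (\<lambda>n. [:fps_nth (fps_X / (fps_exp 1 - 1) :: 'a fps) n:]) *
     Abs_fps (\<lambda>n. monom (1 / fact n) n)"

definition bernoulli_poly :: "nat \<Rightarrow> 'a::field_char_0 poly" where
  "bernoulli_poly n = smult (fact n) (fps_nth bernoulli_gf n)"

lemma bernoulli_poly_gf_quotient:
  fixes x :: "'a::field_char_0"
  shows "Abs_fps (\<lambda>n. poly (bernoulli_poly n) x / fact n) =
           fps_X / (fps_exp 1 - 1) * fps_exp x"
  by (rule fps_ext)
     (simp add: bernoulli_poly_def bernoulli_gf_def fps_mult_nth poly_sum poly_monom)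

lemma bernoulli_poly_gf:
  fixes x :: "'a::field_char_0"
  shows "(fps_exp 1 - 1) * Abs_fps (\<lambda>n. poly (bernoulli_poly n) x / fact n) =
           fps_X * fps_exp x"
proof -
  have nth1: "fps_nth (fps_exp 1 - 1 :: 'a fps) 1 \<noteq> 0"
    by simp
  then have nz: "(fps_exp 1 - 1 :: 'a fps) \<noteq> 0"
    by (metis fps_zero_nth)
  have sub: "subdegree (fps_exp 1 - 1 :: 'a fps) = 1"
    by (rule subdegreeI) (use nth1 in auto)
  have "(fps_exp 1 - 1 :: 'a fps) dvd fps_X"
    using nz sub by (simp add: fps_dvd_iff)
  then have "(fps_exp 1 - 1 :: 'a fps) * (fps_X / (fps_exp 1 - 1)) = fps_X"
    by simp
  then show ?thesis
    unfolding bernoulli_poly_gf_quotient by (simp flip: mult.assoc)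
qed

end

theory Submission
  imports Defs
begin

text \<open>
  Let L be the linear operator on polynomials with L(t^n) = B_n(x). The generating function
  says precisely that L(p(t + 1) - p(t)) = p'(x). For p = t^m (t - 1)^m / 2 the
  difference p(t + 1) - p(t) is t^m ((t + 1)^m - (t - 1)^m) / 2, which keeps just the terms
  of t^m (t + 1)^m with k + m odd. All four identities come from applying L to the
  derivative of this p of order \<open>\<nu> + r\<close>, divided by \<open>\<nu>! r!\<close>, for suitable r.
\<close>

text \<open>Compares the coefficients of \<open>t^n\<close> in
  \<open>(e^t - 1) G(t) = t e^(xt)\<close> and multiplies by \<open>n!\<close>. This is the rule for
  L in the case of the monomial \<open>t^n\<close>.\<close>

lemma sum_bernoulli_poly_diff:
  "(\<Sum>k\<le>n. smult (of_nat (n choose k)) (bernoulli_poly k)) - bernoulli_poly n =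
    (pderiv (monom 1 n) :: 'a::field_char_0 poly)"
proof (rule poly_ext)
  fix x :: 'a
  let ?b = "\<lambda>k. poly (bernoulli_poly k) x"
  let ?G = "Abs_fps (\<lambda>n. ?b n / fact n)"
  have "?G * fps_exp 1 - ?G = fps_X * fps_exp x"
    using bernoulli_poly_gf[of x] by (simp only: left_diff_distrib mult.commute[of ?G] mult_1_left)
  then have "fps_nth (?G * fps_exp 1) n - fps_nth ?G n = fps_nth (fps_X * fps_exp x) n"
    by (simp only: flip: fps_sub_nth)
  then have eq: "(\<Sum>k\<le>n. ?b k / fact k / fact (n - k)) - ?b n / fact n =
      (if n = 0 then 0 else x ^ (n - 1) / fact (n - 1))"
    by (simp add: fps_mult_nth[of ?G] atLeast0AtMost)
  have "(\<Sum>k\<le>n. of_nat (n choose k) * ?b k) - ?b n =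
      fact n * ((\<Sum>k\<le>n. ?b k / fact k / fact (n - k)) - ?b n / fact n)"
    unfolding right_diff_distrib sum_distrib_left
    by (intro arg_cong2[of _ _ _ _ "(-)"] sum.cong) (simp_all add: binomial_fact)
  also have "\<dots> = of_nat n * x ^ (n - 1)"
    unfolding eq by (cases n) (simp_all add: field_simps)
  finally show "poly ((\<Sum>k\<le>n. smult (of_nat (n choose k)) (bernoulli_poly k)) - bernoulli_poly n) x =
      poly (pderiv (monom 1 n)) x"
    by (simp add: poly_sum pderiv_monom poly_monom)
qed

text \<open>The operator L. The argument is read as a polynomial in t and the value as one in x,
  both of the same type.\<close>

definition umbral :: "'a::field_char_0 poly \<Rightarrow> 'a poly" where
  "umbral p = (\<Sum>i\<le>degree p. smult (coeff p i) (bernoulli_poly i))"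

text \<open>A common bound lets polynomials of different degrees be summed over the same range,
  which is what additivity of L requires.\<close>

lemma umbral_eq_sum:
  assumes "degree p \<le> n"
  shows "umbral p = (\<Sum>i\<le>n. smult (coeff p i) (bernoulli_poly i))"
  unfolding umbral_def
  by (rule sum.mono_neutral_left) (use assms in \<open>auto simp: coeff_eq_0\<close>)

lemma umbral_add: "umbral (p + q) = umbral p + umbral q"
  using umbral_eq_sum[of p "max (degree p) (degree q)"] umbral_eq_sum[of q "max (degree p) (degree q)"]
    umbral_eq_sum[of "p + q" "max (degree p) (degree q)"] degree_add_le_max[of p q]
  by (simp add: smult_add_left sum.distrib)

lemma smult_sum_right: "smult c (\<Sum>i\<in>A. f i) = (\<Sum>i\<in>A. smult c (f i))"
  by (induction A rule: infinite_finite_induct) (simp_all add: smult_add_right)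

lemma umbral_smult: "umbral (smult c p) = smult c (umbral p)"
  using umbral_eq_sum[of "smult c p" "degree p"]
  by (simp add: umbral_def smult_sum_right degree_smult_le)

lemma umbral_diff: "umbral (p - q) = umbral p - umbral q"
  using umbral_add[of p "smult (-1) q"] umbral_smult[of "-1" q] by simp

lemma umbral_0 [simp]: "umbral 0 = 0"
  by (simp add: umbral_def)

lemma umbral_sum: "umbral (\<Sum>i\<in>A. f i) = (\<Sum>i\<in>A. umbral (f i))"
  by (induction A rule: infinite_finite_induct) (simp_all add: umbral_add)

lemma umbral_monom: "umbral (monom c n) = smult c (bernoulli_poly n)"
  using umbral_eq_sum[OF degree_monom_le, of c n]
  by (simp add: if_distrib[of "\<lambda>c. smult c _"] cong: if_cong)

text \<open>Used with \<open>c = -1\<close> for \<open>t^m (t - 1)^m\<close>, with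
  \<open>c = 1\<close> for its shift \<open>t^m (t + 1)^m\<close>, and with \<open>m = 0\<close>,
  \<open>c = 1\<close> for a shifted monomial.\<close>

lemma monom_mult_linear_power:
  "monom 1 m * [:c, 1:] ^ n =
    (\<Sum>k\<le>n. monom (of_nat (n choose k) * c ^ (n - k)) (k + m) :: 'a::{idom,ring_char_0} poly)"
  by (rule poly_ext)
     (simp add: poly_sum poly_monom add.commute[of c] binomial_ring sum_distrib_left power_add mult_ac)

lemma pcompose_power: "pcompose (p ^ n) q = pcompose p q ^ n"
  by (induction n) (simp_all add: pcompose_mult pcompose_1)

lemma pcompose_monom: "pcompose (monom c n) q = smult c (q ^ n)"
  by (simp add: monom_altdef pcompose_smult pcompose_power pcompose_pCons)

lemma pderiv_sum: "pderiv (\<Sum>i\<in>A. f i) = (\<Sum>i\<in>A. pderiv (f i))"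
  using higher_pderiv_sum[of 1] by simp

text \<open>Both sides are linear in p, so monomials suffice, and for these it is
  \<open>sum_bernoulli_poly_diff\<close>.\<close>

lemma umbral_difference: "umbral (pcompose p [:1, 1:] - p) = pderiv p"
proof -
  have monom: "umbral (pcompose (monom c n) [:1, 1:] - monom c n) = pderiv (monom c n)"
    for c :: 'a and n
  proof -
    have "pcompose (monom c n) [:1, 1:] = smult c (\<Sum>k\<le>n. monom (of_nat (n choose k)) k)"
      using monom_mult_linear_power[of 0 "1::'a" n]
      by (simp add: pcompose_monom)
    then have "umbral (pcompose (monom c n) [:1, 1:] - monom c n) =
        smult c ((\<Sum>k\<le>n. smult (of_nat (n choose k)) (bernoulli_poly k)) - bernoulli_poly n)"
      by (simp add: umbral_diff umbral_smult umbral_sum umbral_monom smult_diff_right)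
    also have "\<dots> = pderiv (monom c n)"
      by (simp add: sum_bernoulli_poly_diff smult_monom flip: pderiv_smult)
    finally show ?thesis .
  qed
  \<comment> \<open>The separate name q lets the polynomial be expanded into monomials while the p
    inside \<open>coeff p i\<close> stays untouched.\<close>
  have "umbral (pcompose q [:1, 1:] - q) = pderiv q"
    if "q = (\<Sum>i\<le>degree p. monom (coeff p i) i)" for q
    unfolding that by (simp add: pcompose_sum pderiv_sum umbral_sum monom flip: sum_subtractf)
  then show ?thesis
    by (simp add: poly_as_sum_of_monoms)
qed

lemma higher_pderiv_pcompose_shift:
  "(pderiv ^^ n) (pcompose p [:c, 1:]) = pcompose ((pderiv ^^ n) p) [:c, 1 :: 'a::idom:]"
  by (induction n) (simp_all add: pderiv_pcompose pderiv_pCons)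

lemma higher_pderiv_diff:
  "(pderiv ^^ n) (p - q) = (pderiv ^^ n) p - (pderiv ^^ n) (q :: 'a::idom poly)"
  by (induction n) (simp_all add: pderiv_diff)

text \<open>For \<open>i + r \<le> n\<close> this is
  \<open>n! / (n - i - r)! = i! r! (n choose i) ((n - i) choose r)\<close>. Otherwise the derivative
  is 0 and so is one of the binomials, so the truncated exponent does no harm.\<close>

lemma higher_pderiv_monom_binomial:
  "(pderiv ^^ (i + r)) (monom c n) =
    smult (fact i * fact r)
      (monom (c * of_nat ((n choose i) * ((n - i) choose r))) (n - i - r) :: 'a::field_char_0 poly)"
proof (cases "i + r \<le> n")
  case True
  then obtain k where n: "n = k + (i + r)"
    by (metis add.commute le_Suc_ex)
  have "fact k * pochhammer (of_nat (Suc k)) (i + r) = (fact n :: 'a)"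
    using pochhammer_product[of k n "1 :: 'a"] by (simp add: n pochhammer_fact)
  moreover have "n - i = k + r" "n - i - r = k"
    by (simp_all add: n)
  ultimately show ?thesis
    by (intro poly_eqI) (auto simp: coeff_higher_pderiv n binomial_fact field_simps)
next
  case False
  then have "(n choose i) * ((n - i) choose r) = 0"
    by (cases "i \<le> n") (simp_all add: binomial_eq_0)
  with False show ?thesis
    by (intro poly_eqI) (simp add: coeff_higher_pderiv)
qed

text \<open>The third identity with i for \<nu> and r for l, but for arbitrary i and r; the other
  identities are choices of r.\<close>

lemma sum_bernoulli_poly_odd:
  assumes "0 < m"
  shows "(\<Sum>k | k \<in> {0..m-1} \<and> odd (k + m).
      smult (of_nat ((m choose k) * ((k + m) choose i) * ((k + m - i) choose r)))
        (bernoulli_poly (k + m - i - r) :: 'a::field_char_0 poly)) =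
    smult (1/2) (\<Sum>j = 0..m.
      monom ((-1) ^ (j + m) * of_nat ((m choose j) * ((j + m - 1) choose i) *
        ((j + m - i - 1) choose r) * (j + m))) (j + m - i - r - 1))"
    (is "?lhs = smult (1/2) ?rhs")
proof -
  \<comment> \<open>Taken without the factor 1/2, so that a factor 2 is carried along and removed at
    the end.\<close>
  define p :: "'a poly" where "p = monom 1 m * [:-1, 1:] ^ m"
  let ?D = "pderiv ^^ (i + r)"
  let ?c = "fact i * fact r :: 'a"
  let ?K = "{k. k \<in> {0..m-1} \<and> odd (k + m)}"
  have sgn: "(-1) ^ (m - k) = ((-1) ^ (k + m) :: 'a)" if "k \<le> m" for k
    using that by (simp add: minus_one_power_iff)
  have p: "p = (\<Sum>k\<le>m. monom (of_nat (m choose k) * (-1) ^ (k + m)) (k + m))"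
    unfolding p_def monom_mult_linear_power by (intro sum.cong) (simp_all add: sgn)
  have "pcompose p [:1, 1:] = monom 1 m * [:1, 1:] ^ m"
    by (simp add: p_def pcompose_mult pcompose_monom pcompose_power pcompose_pCons monom_altdef mult.commute)
  then have "pcompose p [:1, 1:] - p =
      (\<Sum>k\<le>m. monom (of_nat (m choose k) * (1 - (-1) ^ (k + m))) (k + m))"
    unfolding p monom_mult_linear_power
    by (simp add: diff_monom right_diff_distrib flip: sum_subtractf)
  \<comment> \<open>The factor \<open>1 - (-1)^(k + m)\<close> is 2 for odd \<open>k + m\<close> and
    0 otherwise; the index \<open>k = m\<close> drops out because \<open>m + m\<close> is
    even.\<close>
  also have "\<dots> = (\<Sum>k\<in>?K. monom (2 * of_nat (m choose k)) (k + m))"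
    using assms by (intro sum.mono_neutral_cong_right) (auto simp: le_less minus_one_power_iff)
  finally have diff: "pcompose p [:1, 1:] - p = (\<Sum>k\<in>?K. monom (2 * of_nat (m choose k)) (k + m))" .
  have "smult ?c (smult 2 ?lhs) = umbral (?D (pcompose p [:1, 1:] - p))"
    unfolding diff
    by (simp add: higher_pderiv_sum higher_pderiv_monom_binomial umbral_sum umbral_smult umbral_monom
        smult_sum_right mult_ac)
  \<comment> \<open>Differentiation commutes with the shift, so the rule for L can be applied to
    \<open>?D p\<close>.\<close>
  also have "\<dots> = umbral (pcompose (?D p) [:1, 1:] - ?D p)"
    by (simp add: higher_pderiv_diff higher_pderiv_pcompose_shift)
  \<comment> \<open>Taking the single derivative first produces the factor \<open>j + m\<close> and
    the exponent \<open>j + m - 1\<close> seen in the right-hand side.\<close>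
  also have "\<dots> = ?D (pderiv p)"
    unfolding umbral_difference by (metis funpow_swap1)
  also have "pderiv p = (\<Sum>j=0..m. monom ((-1) ^ (j + m) * of_nat ((m choose j) * (j + m))) (j + m - 1))"
    by (simp add: p pderiv_sum pderiv_monom atLeast0AtMost mult_ac)
  also have "?D \<dots> = smult ?c ?rhs"
    by (simp add: higher_pderiv_sum higher_pderiv_monom_binomial smult_sum_right mult_ac)
  finally have "smult 2 ?lhs = ?rhs"
    by (rule smult_cancel[rotated]) simp
  from arg_cong[OF this, of "smult (1/2)"] show ?thesis
    by (simp only: smult_smult) simp
qed

text \<open>The choice \<open>r = l + m - i\<close> makes the order of the derivative
  \<open>l + m\<close>. Monomials of smaller degree are killed, which leaves
  \<open>k \<ge> l\<close> on the left and \<open>j > l\<close> on the right; there j is then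
  shifted by one.\<close>

lemma sum_bernoulli_poly_odd_high:
  assumes "0 < m" "i \<le> m"
  shows "(\<Sum>k | k \<in> {l..m-1} \<and> odd (k + m).
      smult (of_nat ((m choose k) * ((k + m) choose i) * ((k + m - i) choose (l + m - i))))
        (bernoulli_poly (k - l) :: 'a::field_char_0 poly)) =
    smult (1/2) (\<Sum>j = l..m-1.
      monom ((-1) ^ (j + m + 1) * of_nat ((m choose (j + 1)) * ((j + m) choose i) *
        ((j + m - i) choose (l + m - i)) * (j + m + 1))) (j - l))"
    (is "?lhs = smult (1/2) ?rhs")
proof -
  let ?F = "\<lambda>k. smult (of_nat ((m choose k) * ((k + m) choose i) * ((k + m - i) choose (l + m - i))))
        (bernoulli_poly (k + m - i - (l + m - i)) :: 'a poly)"
  let ?G = "\<lambda>j. monom ((-1) ^ (j + m) * of_nat ((m choose j) * ((j + m - 1) choose i) *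
        ((j + m - i - 1) choose (l + m - i)) * (j + m))) (j + m - i - (l + m - i) - 1) :: 'a poly"
  have "?lhs = (\<Sum>k | k \<in> {0..m-1} \<and> odd (k + m). ?F k)"
    using assms by (intro sum.mono_neutral_cong_left) (auto simp: binomial_eq_0)
  also have "\<dots> = smult (1/2) (\<Sum>j=0..m. ?G j)"
    by (rule sum_bernoulli_poly_odd) fact
  \<comment> \<open>For \<open>j \<le> l\<close> the last binomial vanishes, except when
    \<open>l = 0\<close> and \<open>i = m\<close>: at \<open>j = 0\<close> truncation turns it into
    \<open>0 choose 0\<close>, and \<open>(m - 1) choose m\<close> vanishes instead.\<close>
  also have "(\<Sum>j=0..m. ?G j) = (\<Sum>j\<in>{Suc l..Suc (m-1)}. ?G j)"
    using assms by (intro sum.mono_neutral_right) (auto simp: binomial_eq_0)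
  also have "\<dots> = ?rhs"
    unfolding sum.shift_bounds_cl_Suc_ivl
    by (rule sum.cong) (use assms in \<open>auto simp: algebra_simps\<close>)
  finally show ?thesis .
qed

theorem theorem1p1:
  shows
    "(\<forall>m \<nu> :: nat. 1 \<le> m \<and> \<nu> \<le> m \<longrightarrow>
        (\<Sum>k | k \<in> {0..m-1} \<and> odd (k + m).
           smult (of_nat ((m choose k) * ((k + m) choose \<nu>) * ((k + m - \<nu>) choose (m - \<nu>))))
             (bernoulli_poly k :: 'a::field_char_0 poly))
        = smult (1/2) (\<Sum>j = 0..m-1.
            monom ((-1) ^ (j + m + 1) *
              of_nat ((m choose (j + 1)) * ((j + m) choose \<nu>) *
                      ((j + m - \<nu>) choose (m - \<nu>)) * (j + m + 1))) j))
     \<and>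
     (\<forall>m \<nu> :: nat. 1 \<le> m \<and> \<nu> \<le> m - 1 \<longrightarrow>
        (\<Sum>k | k \<in> {0..m-1} \<and> odd (k + m).
           smult (of_nat ((m choose k) * ((k + m) choose \<nu>) * ((k + m - \<nu>) choose (m - \<nu> - 1))))
             (bernoulli_poly (k + 1) :: 'a poly))
        = smult (1/2) (\<Sum>j = 0..m.
            monom ((-1) ^ (j + m) *
              of_nat ((m choose j) * ((j + m - 1) choose \<nu>) *
                      ((j + m - \<nu> - 1) choose (m - \<nu> - 1)) * (j + m))) j))
     \<and>
     (\<forall>m \<nu> l :: nat. 1 \<le> m \<and> \<nu> \<le> m - 1 \<and> l \<le> m - \<nu> - 1 \<longrightarrow>
        (\<Sum>k | k \<in> {0..m-1} \<and> odd (k + m).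
           smult (of_nat ((m choose k) * ((k + m) choose \<nu>) * ((k + m - \<nu>) choose l)))
             (bernoulli_poly (k + m - \<nu> - l) :: 'a poly))
        = smult (1/2) (\<Sum>j = 0..m.
            monom ((-1) ^ (j + m) *
              of_nat ((m choose j) * ((j + m - 1) choose \<nu>) *
                      ((j + m - \<nu> - 1) choose l) * (j + m))) (j + m - \<nu> - l - 1)))
     \<and>
     (\<forall>m \<nu> l :: nat. 1 \<le> m \<and> \<nu> \<le> m \<and> l \<le> m - 1 \<longrightarrow>
        (\<Sum>k | k \<in> {l..m-1} \<and> odd (k + m).
           smult (of_nat ((m choose k) * ((k + m) choose \<nu>) * ((k + m - \<nu>) choose (l + m - \<nu>))))
             (bernoulli_poly (k - l) :: 'a poly))
        = smult (1/2) (\<Sum>j = l..m-1.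
            monom ((-1) ^ (j + m + 1) *
              of_nat ((m choose (j + 1)) * ((j + m) choose \<nu>) *
                      ((j + m - \<nu>) choose (l + m - \<nu>)) * (j + m + 1))) (j - l)))"
proof (intro conjI allI impI, goal_cases)
  case (1 m \<nu>)
  then show ?case
    \<comment> \<open>The first identity is the fourth at \<open>l = 0\<close>.\<close>
    using sum_bernoulli_poly_odd_high[of m \<nu> 0, where ?'a = 'a] by simp
next
  case (2 m \<nu>)
  \<comment> \<open>With \<open>r = m - \<nu> - 1\<close> the order of the derivative is
    \<open>m - 1\<close>; the bound on \<nu> ensures that no subtraction is truncated.\<close>
  then have "k + m - \<nu> - (m - \<nu> - 1) = k + 1" "j + m - \<nu> - (m - \<nu> - 1) - 1 = j" for k j
    by linarith+
  then show ?case
    using sum_bernoulli_poly_odd[of m \<nu> "m - \<nu> - 1", where ?'a = 'a] 2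
    by simp
next
  case (3 m \<nu> l)
  then show ?case
    using sum_bernoulli_poly_odd[of m \<nu> l, where ?'a = 'a]
    by (simp add: diff_commute)
next
  case (4 m \<nu> l)
  then show ?case
    by (intro sum_bernoulli_poly_odd_high) simp_all
qed

end
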